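(* Let $P,Q$ be two curves in $\mathbb{R}^d$ with $m_1$ and $m_2$ vertices, respectively, let $M=\max\{m_1,m_2\}$, let $r>0$, and let $\delta=2dr$ and $c=4d^{3/2}M$. Let $t$ be uniformly distributed in $[0,\delta)^d$. Then: (i) if $d_{\mathrm{DTW}}(P,Q)<r$, then $\Pr_t\left(h^t_\delta(P)=h^t_\delta(Q)\right)>\frac12$; (ii) if $d_{\mathrm{DTW}}(P,Q)>cr$, then $\Pr_t\left(h^t_\delta(P)=h^t_\delta(Q)\right)=0$.
   Context: A curve in $\mathbb{R}^d$ is given by its finite sequence of vertices $P=p_1,\dots,p_m\in\mathbb{R}^d$, $m\geq 1$; two curves are equal if their vertex sequences are equal. Given curves $P=p_1,\dots,p_{m_1}$ and $Q=q_1,\dots,q_{m_2}$, a traversal is a sequence of index pairs $T=(i_1,j_1),\dots,(i_\ell,j_\ell)$ with $(i_1,j_1)=(1,1)$, $(i_\ell,j_\ell)=(m_1,m_2)$, and, for every $k<\ell$, $i_{k+1}-i_k\in\{0,1\}$, $j_{k+1}-j_k\in\{0,1\}$ and $(i_{k+1}-i_k)+(j_{k+1}-j_k)\ge 1$. The dynamic time warping distance is $d_{\mathrm{DTW}}(P,Q)=\min_T\sum_{(i,j)\in T}\|p_i-q_j\|$, over all traversals $T$, with $\|\cdot\|$ the Euclidean norm. Basic hash function: for $\delta>0$ let $G_\delta=\{(x_1,\dots,x_d): x_i\in\delta\mathbb{Z}\ \forall i\}$ and, for $t\in[0,\delta)^d$, $\widehat G^t_\delta=\{p+t: p\in G_\delta\}$.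 For a curve $P=p_1,\dots,p_m$, the curve $h^t_\delta(P)$ is obtained by (1) replacing each vertex $p_i$ by its closest point $p_i'$ of $\widehat G^t_\delta$ (ties broken by a fixed rule, say the lexicographically smallest closest point), and (2) removing consecutive duplicates, i.e., removing $p_i'$ whenever it is identical to $p_{i-1}'$. *)

theory Defs
  imports "HOL-Probability.Probability" "HOL-Library.Fun_Lexorder"
begin

section \<open>Dynamic time warping\<close>

text \<open>
  A curve in \<open>\<real>\<^sup>d\<close> is a nonempty list of points of type \<open>real ^ 'd\<close>, where \<open>d = CARD('d)\<close>.
  Vertices are indexed from 0, so a traversal runs from \<open>(0, 0)\<close> to \<open>(m\<^sub>1 - 1, m\<^sub>2 - 1)\<close>.
\<close>

definition traversal :: "nat \<Rightarrow> nat \<Rightarrow> (nat \<times> nat) list \<Rightarrow> bool" where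
  "traversal m\<^sub>1 m\<^sub>2 T \<longleftrightarrow>
     T \<noteq> [] \<and> hd T = (0, 0) \<and> last T = (m\<^sub>1 - 1, m\<^sub>2 - 1) \<and>
     (\<forall>k. Suc k < length T \<longrightarrow>
        (\<exists>a\<in>{0, 1}. \<exists>b\<in>{0, 1}. a + b \<ge> 1 \<and>
           T ! Suc k = (fst (T ! k) + a, snd (T ! k) + b)))"

definition dtw :: "(real ^ 'd) list \<Rightarrow> (real ^ 'd) list \<Rightarrow> real" where
  "dtw P Q =
     Min {(\<Sum>(i, j)\<leftarrow>T. norm (P ! i - Q ! j)) | T. traversal (length P) (length Q) T}"

text \<open>The minimum ranges over a finite nonempty set.\<close>

lemma traversal_mono:
  assumes "traversal m\<^sub>1 m\<^sub>2 T" "l < length T" "k \<le> l"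
  shows "fst (T ! k) \<le> fst (T ! l) \<and> snd (T ! k) \<le> snd (T ! l) \<and>
         fst (T ! k) + snd (T ! k) + (l - k) \<le> fst (T ! l) + snd (T ! l)"
  using assms(3,2)
proof (induction l rule: dec_induct)
  case (step l)
  from assms(1) step.prems obtain a b where "a + b \<ge> 1"
    "T ! Suc l = (fst (T ! l) + a, snd (T ! l) + b)"
    unfolding traversal_def by meson
  with step.IH step.hyps(1) step.prems show ?case by (simp add: Suc_diff_le)
qed simp

lemma finite_traversals: "finite {T. traversal m\<^sub>1 m\<^sub>2 T}"
proof (rule finite_subset)
  show "{T. traversal m\<^sub>1 m\<^sub>2 T} \<subseteq>
      {T. set T \<subseteq> {..m\<^sub>1 - 1} \<times> {..m\<^sub>2 - 1} \<and> length T \<le> m\<^sub>1 + m\<^sub>2 + 1}"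
  proof (rule Collect_mono, rule impI, rule conjI)
    fix T assume T: "traversal m\<^sub>1 m\<^sub>2 T"
    define n where "n = length T - 1"
    from T have n: "n < length T" "length T = Suc n" "T ! n = (m\<^sub>1 - 1, m\<^sub>2 - 1)"
      by (auto simp: traversal_def n_def last_conv_nth)
    show "set T \<subseteq> {..m\<^sub>1 - 1} \<times> {..m\<^sub>2 - 1}"
    proof
      fix x assume "x \<in> set T"
      then obtain k where "k \<le> n" "x = T ! k" using n(2) by (auto simp: in_set_conv_nth less_Suc_eq_le)
      with traversal_mono[OF T n(1), of k] n(3) show "x \<in> {..m\<^sub>1 - 1} \<times> {..m\<^sub>2 - 1}"
        by (auto simp: mem_Times_iff)
    qed
    show "length T \<le> m\<^sub>1 + m\<^sub>2 + 1"
      using traversal_mono[OF T n(1), of 0] n by auto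
  qed
qed (intro finite_lists_length_le; simp)

lemma traversal_exists: "\<exists>T. traversal m\<^sub>1 m\<^sub>2 T"
proof -
  have "\<exists>T. traversal (Suc a) (Suc b) T" for a b
  proof (induction a)
    case 0
    show ?case
      unfolding traversal_def
      by (rule exI[of _ "map (Pair 0) [0..<Suc b]"])
         (simp add: hd_map last_map del: upt_Suc)
  next
    case (Suc a)
    then obtain T where T: "traversal (Suc a) (Suc b) T" by blast
    define n where "n = length T - 1"
    from T have n: "length T = Suc n" "T ! n = (a, b)" and
      step: "\<And>k. k < n \<Longrightarrow> \<exists>x\<in>{0, 1}. \<exists>y\<in>{0, 1}. x + y \<ge> 1 \<and>
        T ! Suc k = (fst (T ! k) + x, snd (T ! k) + y)"
      by (auto simp: traversal_def n_def last_conv_nth)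
    have "traversal (Suc (Suc a)) (Suc b) (T @ [(Suc a, b)])"
      unfolding traversal_def
    proof (intro conjI allI impI)
      fix k assume "Suc k < length (T @ [(Suc a, b)])"
      then consider "k < n" | "k = n" using n(1) by fastforce
      then show "\<exists>x\<in>{0, 1}. \<exists>y\<in>{0, 1}. x + y \<ge> 1 \<and> (T @ [(Suc a, b)]) ! Suc k =
          (fst ((T @ [(Suc a, b)]) ! k) + x, snd ((T @ [(Suc a, b)]) ! k) + y)"
      proof cases
        case 1
        with step[OF 1] n(1) show ?thesis by (simp add: nth_append)
      next
        case 2
        with n show ?thesis
          by (intro bexI[of _ 1] bexI[of _ 0]) (simp_all add: nth_append)
      qed
    qed (use T in \<open>auto simp: traversal_def\<close>)
    then show ?case by blast
  qed
  from this[of "m\<^sub>1 - 1" "m\<^sub>2 - 1"] show ?thesis by (simp add: traversal_def)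
qed


section \<open>The randomly shifted grid hash\<close>

definition grid :: "real \<Rightarrow> (real ^ 'd) set" where
  "grid \<delta> = {x. \<forall>i. \<exists>k::int. x $ i = \<delta> * of_int k}"

definition shifted_grid :: "real \<Rightarrow> real ^ 'd \<Rightarrow> (real ^ 'd) set" where
  "shifted_grid \<delta> t = {p + t | p. p \<in> grid \<delta>}"

definition closest_points :: "(real ^ 'd) set \<Rightarrow> real ^ 'd \<Rightarrow> (real ^ 'd) set" where
  "closest_points G p = {g \<in> G. \<forall>g'\<in>G. dist p g \<le> dist p g'}"

text \<open>
  Ties are broken towards the lexicographically smallest closest point. The coordinate type
  carries a linear order to give this a meaning; the order \<open>\<le>\<close> on vectors is the componentwise
  partial order and is not used.
\<close>

definition snap ::
  "real \<Rightarrow> real ^ 'd::{finite,linorder} \<Rightarrow> real ^ 'd::{finite,linorder} \<Rightarrow>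
   real ^ 'd::{finite,linorder}" where
  "snap \<delta> t p =
     (THE g. g \<in> closest_points (shifted_grid \<delta> t) p \<and>
        (\<forall>g'\<in>closest_points (shifted_grid \<delta> t) p.
            g' = g \<or> less_fun (vec_nth g) (vec_nth g')))"

definition hash ::
  "real \<Rightarrow> real ^ 'd::{finite,linorder} \<Rightarrow> (real ^ 'd::{finite,linorder}) list \<Rightarrow>
   (real ^ 'd::{finite,linorder}) list" where
  "hash \<delta> t P = remdups_adj (map (snap \<delta> t) P)"

definition offsets :: "real \<Rightarrow> (real ^ 'd) set" where
  "offsets \<delta> = {t. \<forall>i. 0 \<le> t $ i \<and> t $ i < \<delta>}"

definition random_offset :: "real \<Rightarrow> (real ^ 'd) measure" where
  "random_offset \<delta> = uniform_measure lborel (offsets \<delta>)"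

text \<open>
  The definite description in \<^const>\<open>snap\<close> denotes: the lexicographically smallest closest point
  exists and is obtained by rounding each coordinate, half-way values downwards.
\<close>

definition rnd :: "real \<Rightarrow> real \<Rightarrow> int" where
  "rnd \<delta> x = \<lceil>x / \<delta> - 1 / 2\<rceil>"

lemma rnd_closest:
  fixes k :: int
  assumes "\<delta> > 0"
  shows "\<bar>x - \<delta> * rnd \<delta> x\<bar> \<le> \<bar>x - \<delta> * k\<bar>"
    and "\<bar>x - \<delta> * k\<bar> \<le> \<bar>x - \<delta> * rnd \<delta> x\<bar> \<Longrightarrow> rnd \<delta> x \<le> k"
proof -
  define y where "y = x / \<delta>"
  define c where "c = rnd \<delta> x"
  have eq: "\<bar>x - \<delta> * l\<bar> = \<delta> * \<bar>y - l\<bar>" for l :: real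
  proof -
    have "x - \<delta> * l = \<delta> * (y - l)" using assms by (simp add: y_def field_simps)
    then show ?thesis using assms by (simp add: abs_mult)
  qed
  have b: "of_int c \<ge> y - 1 / 2" "of_int c < y + 1 / 2"
    using ceiling_correct[of "y - 1/2"] unfolding c_def rnd_def y_def by linarith+
  have "k = c \<or> k \<le> c - 1 \<or> k \<ge> c + 1" by linarith
  then have k: "k = c \<or> real_of_int k \<le> real_of_int c - 1 \<or> real_of_int k \<ge> real_of_int c + 1"
    by linarith
  then have "\<bar>y - of_int c\<bar> \<le> \<bar>y - of_int k\<bar>" using b by linarith
  then show "\<bar>x - \<delta> * rnd \<delta> x\<bar> \<le> \<bar>x - \<delta> * k\<bar>"
    unfolding eq using assms by (simp add: c_def)
  assume "\<bar>x - \<delta> * k\<bar> \<le> \<bar>x - \<delta> * rnd \<delta> x\<bar>"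
  then have "\<bar>y - of_int k\<bar> \<le> \<bar>y - of_int c\<bar>" unfolding eq using assms by (simp add: c_def)
  then have "of_int c \<le> real_of_int k" using k b by linarith
  then show "rnd \<delta> x \<le> k" by (simp add: c_def)
qed

lemma less_fun_if_le:
  fixes f g :: "'a::{finite,linorder} \<Rightarrow> 'b::linorder"
  assumes "\<And>i. f i \<le> g i" "f \<noteq> g"
  shows "less_fun f g"
proof -
  define A where "A = {i. f i \<noteq> g i}"
  have "finite A" "A \<noteq> {}" using assms(2) by (auto simp: A_def)
  then have "Min A \<in> A" by (rule Min_in)
  then have "f (Min A) \<noteq> g (Min A)" unfolding A_def by (rule CollectD)
  with assms(1) have "f (Min A) < g (Min A)" by (rule le_neq_trans)
  moreover have "\<forall>i < Min A. f i = g i"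
  proof (intro allI impI)
    fix i assume "i < Min A"
    with \<open>finite A\<close> have "i \<notin> A" using Min_le leD by blast
    then show "f i = g i" unfolding A_def by blast
  qed
  ultimately show ?thesis unfolding less_fun_def by blast
qed

lemma snap_eq:
  fixes t p :: "real ^ 'd::{finite,linorder}"
  assumes "\<delta> > 0"
  shows "snap \<delta> t p = (\<chi> i. t $ i + \<delta> * rnd \<delta> (p $ i - t $ i))"
proof -
  define s where "s = (\<chi> i. t $ i + \<delta> * rnd \<delta> (p $ i - t $ i))"
  have G: "g \<in> shifted_grid \<delta> t \<longleftrightarrow> (\<forall>i. \<exists>k::int. g $ i = t $ i + \<delta> * k)" for g
  proof
    assume R: "\<forall>i. \<exists>k::int. g $ i = t $ i + \<delta> * k"
    have "(g - t) \<in> grid \<delta>" using R by (auto simp: grid_def algebra_simps)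
    then have "(g - t) + t \<in> shifted_grid \<delta> t" unfolding shifted_grid_def by blast
    then show "g \<in> shifted_grid \<delta> t" by simp
  qed (auto simp: shifted_grid_def grid_def add.commute)
  have sG: "s \<in> shifted_grid \<delta> t" by (auto simp: G s_def)
  have dist_eq: "dist p g = L2_set (\<lambda>i. \<bar>p $ i - g $ i\<bar>) UNIV" for g
    by (simp add: dist_norm norm_vec_def)
  have le: "\<bar>p $ i - s $ i\<bar> \<le> \<bar>p $ i - g $ i\<bar>"
    and least: "\<bar>p $ i - g $ i\<bar> \<le> \<bar>p $ i - s $ i\<bar> \<Longrightarrow> s $ i \<le> g $ i"
    if "g \<in> shifted_grid \<delta> t" for g i
  proof -
    from that obtain k :: int where "g $ i = t $ i + \<delta> * k" by (auto simp: G)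
    with rnd_closest[OF assms, of "p $ i - t $ i" k] assms
    show "\<bar>p $ i - s $ i\<bar> \<le> \<bar>p $ i - g $ i\<bar>"
      "\<bar>p $ i - g $ i\<bar> \<le> \<bar>p $ i - s $ i\<bar> \<Longrightarrow> s $ i \<le> g $ i"
      by (auto simp: s_def algebra_simps)
  qed
  have s: "s \<in> closest_points (shifted_grid \<delta> t) p"
    unfolding closest_points_def dist_eq
    by (intro CollectI conjI ballI L2_set_mono sG le) auto
  have lex: "g = s \<or> less_fun (vec_nth s) (vec_nth g)"
    if g: "g \<in> closest_points (shifted_grid \<delta> t) p" for g
  proof -
    from g have gG: "g \<in> shifted_grid \<delta> t" and "dist p g \<le> dist p s"
      using sG by (auto simp: closest_points_def)
    then have sq: "(\<Sum>i\<in>UNIV. \<bar>p $ i - g $ i\<bar>\<^sup>2) \<le> (\<Sum>i\<in>UNIV. \<bar>p $ i - s $ i\<bar>\<^sup>2)"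
      by (simp add: dist_eq L2_set_def)
    have "\<bar>p $ i - g $ i\<bar> \<le> \<bar>p $ i - s $ i\<bar>" for i
    proof (rule ccontr)
      assume i: "\<not> \<bar>p $ i - g $ i\<bar> \<le> \<bar>p $ i - s $ i\<bar>"
      have "(\<Sum>i\<in>UNIV. \<bar>p $ i - s $ i\<bar>\<^sup>2) < (\<Sum>i\<in>UNIV. \<bar>p $ i - g $ i\<bar>\<^sup>2)"
      proof (rule sum_strict_mono_ex1)
        show "\<forall>i\<in>UNIV. \<bar>p $ i - s $ i\<bar>\<^sup>2 \<le> \<bar>p $ i - g $ i\<bar>\<^sup>2"
          by (intro ballI power_mono le[OF gG] abs_ge_zero)
        have "\<bar>p $ i - s $ i\<bar>\<^sup>2 < \<bar>p $ i - g $ i\<bar>\<^sup>2"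
          using i by (intro power_strict_mono) auto
        then show "\<exists>a\<in>UNIV. \<bar>p $ a - s $ a\<bar>\<^sup>2 < \<bar>p $ a - g $ a\<bar>\<^sup>2" by blast
      qed simp
      with sq show False by simp
    qed
    with least[OF gG] have "\<And>i. s $ i \<le> g $ i" by blast
    then show ?thesis
      using less_fun_if_le[of "vec_nth s" "vec_nth g"] by (auto simp: vec_nth_inject)
  qed
  show ?thesis unfolding snap_def s_def[symmetric]
  proof (rule the_equality)
    show "s \<in> closest_points (shifted_grid \<delta> t) p \<and>
        (\<forall>g'\<in>closest_points (shifted_grid \<delta> t) p.
            g' = s \<or> less_fun (vec_nth s) (vec_nth g'))"
      using s lex by blast
  next
    fix g
    assume "g \<in> closest_points (shifted_grid \<delta> t) p \<and>
        (\<forall>g'\<in>closest_points (shifted_grid \<delta> t) p.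
            g' = g \<or> less_fun (vec_nth g) (vec_nth g'))"
    then have "g = s \<or> less_fun (vec_nth g) (vec_nth s)" "g = s \<or> less_fun (vec_nth s) (vec_nth g)"
      using s lex[of g] by auto
    then show "g = s" using less_fun_asym[of "vec_nth g" "vec_nth s"] by blast
  qed
qed

text \<open>
  Probabilities of hash collisions are meaningful: \<^const>\<open>random_offset\<close> is a probability measure,
  and equality of the hashes is an event of it.
\<close>

lemma sets_random_offset [simp, measurable_cong]: "sets (random_offset \<delta>) = sets borel"
  by (simp add: random_offset_def)

lemma space_random_offset [simp]: "space (random_offset \<delta>) = UNIV"
  by (simp add: random_offset_def)

lemma prob_space_random_offset:
  assumes "\<delta> > 0"
  shows "prob_space (random_offset \<delta> :: (real ^ 'd) measure)"
  unfolding random_offset_def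
proof (rule prob_space_uniform_measure)
  let ?O = "offsets \<delta> :: (real ^ 'd) set"
  have sub: "box 0 (\<chi> i. \<delta>) \<subseteq> ?O" "?O \<subseteq> cbox 0 (\<chi> i. \<delta>)"
    by (force simp: offsets_def mem_box_cart less_imp_le)+
  have meas: "?O \<in> sets borel" unfolding offsets_def by measurable
  have "emeasure lborel ?O \<le> emeasure lborel (cbox 0 (\<chi> i. \<delta>) :: (real ^ 'd) set)"
    using sub by (intro emeasure_mono) auto
  also have "\<dots> < \<infinity>" by (rule emeasure_lborel_cbox_finite)
  finally show "emeasure lborel ?O \<noteq> \<infinity>" by simp
  have "0 < emeasure lborel (box 0 (\<chi> i. \<delta>) :: (real ^ 'd) set)"
    using assms by (auto simp: emeasure_lborel_box_eq Basis_vec_def inner_axis intro!: prod_pos)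
  also have "\<dots> \<le> emeasure lborel ?O"
    using sub meas by (intro emeasure_mono) auto
  finally show "emeasure lborel ?O \<noteq> 0" by simp
qed

lemma hash_eq_event:
  fixes P Q :: "(real ^ 'd::{finite,linorder}) list"
  assumes "\<delta> > 0"
  shows "{t \<in> space (random_offset \<delta>). hash \<delta> t P = hash \<delta> t Q} \<in> sets (random_offset \<delta>)"
proof -
  define K where "K t p = (\<chi> i. rnd \<delta> (p $ i - t $ i))" for t p :: "real ^ 'd::{finite,linorder}"
  define E where "E t k = (\<chi> i. t $ i + \<delta> * of_int (k $ i))"
    for t :: "real ^ 'd::{finite,linorder}" and k :: "int ^ 'd::{finite,linorder}"
  have inj: "inj (E t)" for t
    using assms by (auto simp: inj_def E_def vec_eq_iff)
  have "snap \<delta> t = (\<lambda>p. E t (K t p))" for t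
    using assms by (auto simp: snap_eq E_def K_def)
  then have h: "hash \<delta> t P = map (E t) (remdups_adj (map (K t) P))" for t P
    by (simp add: hash_def remdups_adj_map_injective[OF inj, symmetric] comp_def)
  have eq: "hash \<delta> t P = hash \<delta> t Q \<longleftrightarrow>
      remdups_adj (map (K t) P) = remdups_adj (map (K t) Q)" for t
    by (simp add: h inj_map_eq_map[OF inj])
  have [measurable]: "(\<lambda>t. rnd \<delta> (p $ i - t $ i)) \<in> measurable borel (count_space UNIV)"
    for p :: "real ^ 'd::{finite,linorder}" and i unfolding rnd_def by measurable
  have single: "Measurable.pred borel (\<lambda>t. K t p = k)" for p k
    unfolding K_def vec_eq_iff by simp
  have list: "Measurable.pred borel (\<lambda>t. map (K t) R = U)" for R U
  proof (induction R arbitrary: U)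
    case (Cons p R)
    note [measurable] = single Cons.IH
    show ?case by (cases U) simp_all
  qed simp
  have "{t \<in> space (random_offset \<delta>). hash \<delta> t P = hash \<delta> t Q} =
      (\<Union>(U, V)\<in>{(U, V). remdups_adj U = remdups_adj V}.
         {t \<in> space borel. map (K t) P = U \<and> map (K t) Q = V})"
    by (auto simp: eq)
  also have "\<dots> \<in> sets borel"
  proof (rule sets.countable_UN'')
    fix UV :: "(int ^ 'd::{finite,linorder}) list \<times> (int ^ 'd::{finite,linorder}) list"
    note [measurable] = list
    show "(case UV of (U, V) \<Rightarrow>
        {t \<in> space borel. map (K t) P = U \<and> map (K t) Q = V}) \<in> sets borel"
      by (cases UV) simp
  qed (rule countableI_type)
  finally show ?thesis by simp
qed

end

(* If the snapped vertices agree along every pair of an optimal traversal, both hashes are the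
   duplicate-free form of the same sequence. Each coordinate of a pair is separated by the
   random grid with probability at most its distance over \<delta>, and a union bound over the pairs of
   the traversal and the d coordinates gives failure probability at most d * dtw P Q / \<delta> < 1/2.
   Conversely, equal hashes yield a traversal all of whose pairs snap to the same grid point, hence
   have distance at most sqrt d * \<delta>; it has at most m1 + m2 - 1 pairs. *)

theory Submission
  imports Defs
begin

section \<open>Traversals and removal of adjacent duplicates\<close>

text \<open>Repeating an index only creates an adjacent duplicate, and every other step moves to the
  next entry, so nothing is skipped. The start \<open>hd I\<close> is left general for the
  induction; traversals start at 0.\<close>

lemma remdups_adj_map_nth:
  assumes "I \<noteq> []" "last I = length xs - 1" "xs \<noteq> []"
    and "successively (\<lambda>i j. j = i \<or> j = Suc i) I"
  shows "hd I < length xs \<and> remdups_adj (map ((!) xs) I) = remdups_adj (drop (hd I) xs)"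
  using assms
proof (induction I rule: induct_list012)
  case (2 i)
  then have "drop i xs = [xs ! i]"
    by (simp add: Cons_nth_drop_Suc[symmetric])
  with 2 show ?case by simp
next
  case (3 i j I)
  then have IH: "j < length xs" "remdups_adj (map ((!) xs) (j # I)) = remdups_adj (drop j xs)"
    by auto
  from 3 consider "j = i" | "j = Suc i" by auto
  then show ?case
  proof cases
    case 1
    with IH show ?thesis by simp
  next
    case 2
    then have "drop i xs = xs ! i # xs ! j # drop (Suc j) xs" "drop j xs = xs ! j # drop (Suc j) xs"
      using IH(1) by (simp_all add: Cons_nth_drop_Suc)
    with IH 2 show ?thesis by auto
  qed
qed simp

lemma traversal_components:
  assumes "traversal m\<^sub>1 m\<^sub>2 T"
  shows "successively (\<lambda>i j. j = i \<or> j = Suc i) (map fst T)"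
    and "successively (\<lambda>i j. j = i \<or> j = Suc i) (map snd T)"
proof -
  have step: "\<exists>a\<in>{0, 1}. \<exists>b\<in>{0, 1}. T ! Suc k = (fst (T ! k) + a, snd (T ! k) + b)"
    if "Suc k < length T" for k
    using assms that unfolding traversal_def by meson
  show "successively (\<lambda>i j. j = i \<or> j = Suc i) (map fst T)"
    "successively (\<lambda>i j. j = i \<or> j = Suc i) (map snd T)"
    using step by (fastforce simp: successively_conv_nth)+
qed

text \<open>Read along \<open>T\<close>, both lists become one and the same list, and the
  repetitions introduced this way are invisible to \<open>remdups_adj\<close>.\<close>

lemma remdups_adj_eq_if_traversal:
  assumes T: "traversal (length xs) (length ys) T" and "xs \<noteq> []" "ys \<noteq> []"
    and eq: "\<And>i j. (i, j) \<in> set T \<Longrightarrow> xs ! i = ys ! j"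
  shows "remdups_adj xs = remdups_adj ys"
proof -
  have ends: "T \<noteq> []" "hd T = (0, 0)" "last T = (length xs - 1, length ys - 1)"
    using T by (auto simp: traversal_def)
  have "remdups_adj (map ((!) xs) (map fst T)) = remdups_adj xs"
    using remdups_adj_map_nth[OF _ _ \<open>xs \<noteq> []\<close> traversal_components(1)[OF T]] ends
    by (simp add: hd_map last_map)
  moreover have "remdups_adj (map ((!) ys) (map snd T)) = remdups_adj ys"
    using remdups_adj_map_nth[OF _ _ \<open>ys \<noteq> []\<close> traversal_components(2)[OF T]] ends
    by (simp add: hd_map last_map)
  moreover have "map ((!) xs) (map fst T) = map ((!) ys) (map snd T)"
    using eq by auto
  ultimately show ?thesis by metis
qed

section \<open>Traversals built from equal duplicate-free forms\<close>

text \<open>This grows a traversal at its front: the new first step goes from (0, 0) to (a, b), the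
  shifted old start.\<close>

lemma traversal_Cons:
  assumes T: "traversal m n T" and "m > 0" "n > 0"
    and ab: "a \<in> {0, 1}" "b \<in> {0, 1}" "a + b \<ge> 1"
  shows "traversal (m + a) (n + b) ((0, 0) # map (\<lambda>(i, j). (i + a, j + b)) T)"
    (is "traversal _ _ (_ # ?T)")
  unfolding traversal_def
proof (intro conjI allI impI)
  have ends: "T \<noteq> []" "hd T = (0, 0)" "last T = (m - 1, n - 1)"
    using T by (auto simp: traversal_def)
  \<comment> \<open>Subtraction is truncated, so m - 1 + a = m + a - 1 rests on m > 0, and likewise
    for n.\<close>
  show "last ((0, 0) # ?T) = (m + a - 1, n + b - 1)"
    using ends assms(2,3) by (simp add: last_map)
  fix k assume k: "Suc k < length ((0, 0) # ?T)"
  show "\<exists>x\<in>{0, 1}. \<exists>y\<in>{0, 1}. x + y \<ge> 1 \<and> ((0, 0) # ?T) ! Suc k =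
      (fst (((0, 0) # ?T) ! k) + x, snd (((0, 0) # ?T) ! k) + y)"
  proof (cases k)
    case 0
    with ends have "((0, 0) # ?T) ! Suc k = (a, b)"
      by (simp add: hd_conv_nth)
    with 0 ab show ?thesis by (intro bexI[of _ a] bexI[of _ b]) auto
  next
    case (Suc l)
    then have "Suc l < length T" using k by simp
    then obtain x y where "x \<in> {0, 1}" "y \<in> {0, 1}" "x + y \<ge> 1"
      "T ! Suc l = (fst (T ! l) + x, snd (T ! l) + y)"
      using T unfolding traversal_def by meson
    with Suc \<open>Suc l < length T\<close> show ?thesis
      by (intro bexI[of _ x] bexI[of _ y]) (auto simp: case_prod_beta)
  qed
qed simp_all

text \<open>Equal duplicate-free forms have the same head, so (0, 0) is a matching pair. A head that
  is repeated is dropped from its own list alone; if neither head is repeated and both tails are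
  nonempty, both heads are dropped. The remaining lists again have equal duplicate-free
  forms.\<close>

lemma traversal_if_remdups_adj_eq:
  assumes "remdups_adj xs = remdups_adj ys" "xs \<noteq> []" "ys \<noteq> []"
  shows "\<exists>T. traversal (length xs) (length ys) T \<and> (\<forall>(i, j)\<in>set T. xs ! i = ys ! j)"
  using assms
proof (induction "length xs + length ys" arbitrary: xs ys rule: less_induct)
  case less
  obtain x xs' y ys' where xy: "xs = x # xs'" "ys = y # ys'"
    using less.prems by (auto simp: neq_Nil_conv)
  have "x = y"
    using less.prems(1) by (metis xy hd_remdups_adj list.sel(1))
  \<comment> \<open>Shared by the three recursive cases. The condition a + b >= 1 serves twice: the
    total length decreases, and (0, 0) to (a, b) is a legal step.\<close>
  have extend: ?case
    if "remdups_adj us = remdups_adj vs" "us \<noteq> []" "vs \<noteq> []" "a \<in> {0, 1}" "b \<in> {0, 1}" "a + b \<ge> 1"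
      "us = drop a xs" "vs = drop b ys" for us vs a b
  proof -
    have len: "length us + a = length xs" "length vs + b = length ys"
      using that by auto
    then have "length us + length vs < length xs + length ys"
      using that by linarith
    from less.hyps[OF this that(1-3)] obtain T
      where T: "traversal (length us) (length vs) T" "\<forall>(i, j)\<in>set T. us ! i = vs ! j" by blast
    have "us ! i = xs ! (i + a)" "vs ! i = ys ! (i + b)" for i
      using that len by (simp_all add: add.commute)
    with T(2) \<open>x = y\<close> have "\<forall>(i, j)\<in>set ((0, 0) # map (\<lambda>(i, j). (i + a, j + b)) T). xs ! i = ys ! j"
      by (auto simp: xy)
    moreover have "traversal (length xs) (length ys) ((0, 0) # map (\<lambda>(i, j). (i + a, j + b)) T)"
      using traversal_Cons[OF T(1)] that len by (metis length_greater_0_conv)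
    ultimately show ?case by blast
  qed
  consider "xs' = []" "ys' = []" | u where "xs' = x # u" | u where "ys' = y # u"
    | "xs' = []" "ys' \<noteq> []" "hd ys' \<noteq> y" | "xs' \<noteq> []" "hd xs' \<noteq> x" "ys' = []"
    | "xs' \<noteq> []" "hd xs' \<noteq> x" "ys' \<noteq> []" "hd ys' \<noteq> y"
    by (metis list.collapse)
  then show ?case
  proof cases
    case 1
    then show ?thesis
      using xy \<open>x = y\<close> by (intro exI[of _ "[(0, 0)]"]) (simp add: traversal_def)
  next
    case 2
    then show ?thesis using less.prems xy by (intro extend[of xs' ys 1 0]) auto
  next
    case 3
    then show ?thesis using less.prems xy by (intro extend[of xs ys' 0 1]) auto
  next
    case 4
    \<comment> \<open>\<open>xs\<close> is a single entry and the head of \<open>ys\<close> is not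
      repeated, so the nonempty \<open>ys'\<close> would have to reduce to nothing.\<close>
    then have "remdups_adj ys' = []"
      using less.prems(1) xy by (cases ys') auto
    then show ?thesis using \<open>ys' \<noteq> []\<close> by simp
  next
    case 5
    then have "remdups_adj xs' = []"
      using less.prems(1) xy by (cases xs') auto
    then show ?thesis using \<open>xs' \<noteq> []\<close> by simp
  next
    case 6
    then show ?thesis
      using less.prems xy by (intro extend[of xs' ys' 1 1]) (auto simp: neq_Nil_conv)
  qed
qed

section \<open>Length and index range of traversals\<close>

lemma traversal_last:
  assumes "traversal m n T"
  obtains l where "length T = Suc l" "T ! l = (m - 1, n - 1)"
proof
  show "length T = Suc (length T - 1)" "T ! (length T - 1) = (m - 1, n - 1)"
    using assms by (auto simp: traversal_def last_conv_nth)
qed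

text \<open>Every step raises the coordinate sum by at least one, and this sum runs from 0 to m + n
  - 2.\<close>

lemma length_traversal_le:
  assumes "traversal m n T" "m > 0" "n > 0"
  shows "length T \<le> m + n - 1"
proof -
  obtain l where "length T = Suc l" "T ! l = (m - 1, n - 1)"
    using assms(1) by (rule traversal_last)
  with traversal_mono[OF assms(1), of l 0] assms(2,3) have "l \<le> (m - 1) + (n - 1)" by simp
  with \<open>length T = Suc l\<close> assms(2,3) show ?thesis by linarith
qed

lemma traversal_less:
  assumes "traversal m n T" "m > 0" "n > 0" "(i, j) \<in> set T"
  shows "i < m" "j < n"
proof -
  obtain l where l: "length T = Suc l" "T ! l = (m - 1, n - 1)"
    using assms(1) by (rule traversal_last)
  obtain k where "k < length T" "T ! k = (i, j)"
    using assms(4) unfolding in_set_conv_nth by blast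
  with l traversal_mono[OF assms(1), of l k] assms(2,3) show "i < m" "j < n" by auto
qed

section \<open>Collision probabilities\<close>

(* The shifts separating p and q form an interval of length q - p modulo \<delta>; it may wrap around. *)
lemma rnd_neq_subset_intervals:
  assumes "\<delta> > 0"
  shows "\<exists>a b a' b'. 0 \<le> a \<and> a \<le> b \<and> b \<le> \<delta> \<and> 0 \<le> a' \<and> a' \<le> b' \<and> b' \<le> \<delta> \<and>
    (b - a) + (b' - a') \<le> \<bar>p - q\<bar> \<and>
    {s. 0 \<le> s \<and> s < \<delta> \<and> rnd \<delta> (p - s) \<noteq> rnd \<delta> (q - s)} \<subseteq> {a..b} \<union> {a'..b'}"
proof (induction p q rule: linorder_wlog)
  case (sym p q)
  then show ?case by (simp only: abs_minus_commute[of q p] eq_commute[of "rnd \<delta> (q - _)"])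
next
  case (le p q)
  show ?case
  proof (cases "q - p \<ge> \<delta>")
    case True
    \<comment> \<open>The bound now allows all of [0, \<delta>]; the second interval is
      degenerate.\<close>
    with assms show ?thesis
      by (intro exI[of _ 0] exI[of _ \<delta>] exI[of _ 0] exI[of _ 0]) auto
  next
    case False
    \<comment> \<open>As s varies, \<open>rnd \<delta> (p - s)\<close> jumps at the points congruent
      to p - \<delta>/2 modulo \<delta>. The representative in [0, \<delta>) is \<alpha>, and
      \<beta> is the jump point for q moved by the same multiple of \<delta>.\<close>
    define k where "k = \<lfloor>p / \<delta> - 1 / 2\<rfloor>"
    define \<alpha> where "\<alpha> = p - \<delta> / 2 - \<delta> * k"
    define \<beta> where "\<beta> = q - \<delta> / 2 - \<delta> * k"
    have \<alpha>: "0 \<le> \<alpha>" "\<alpha> < \<delta>"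
    proof -
      have "\<alpha> = \<delta> * (p / \<delta> - 1 / 2 - k)" using assms by (simp add: \<alpha>_def field_simps)
      moreover have "0 \<le> p / \<delta> - 1 / 2 - k" "p / \<delta> - 1 / 2 - k < 1"
        unfolding k_def by linarith+
      ultimately show "0 \<le> \<alpha>" "\<alpha> < \<delta>" using assms by auto
    qed
    have w: "\<beta> - \<alpha> = q - p" by (simp add: \<alpha>_def \<beta>_def)
    \<comment> \<open>Separating shifts lie in translates of [\<alpha>, \<beta>) by multiples of
      \<delta>. Since 0 <= \<alpha> < \<delta> and \<beta> < 2\<delta>, only the translates by 0 and
      by -\<delta> can meet [0, \<delta>).\<close>
    have cover: "\<alpha> \<le> s \<and> s \<le> \<beta> \<or> s \<le> \<beta> - \<delta>"
      if s: "0 \<le> s" "s < \<delta>" "rnd \<delta> (p - s) \<noteq> rnd \<delta> (q - s)" for s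
    proof -
      define l where "l = rnd \<delta> (p - s)"
      have "rnd \<delta> (p - s) \<le> rnd \<delta> (q - s)"
        using assms le unfolding rnd_def by (intro ceiling_mono) (simp add: divide_right_mono)
      with s have "l < (q - s) / \<delta> - 1 / 2"
        unfolding l_def rnd_def by linarith
      moreover have "(p - s) / \<delta> - 1 / 2 \<le> l"
        unfolding l_def rnd_def by linarith
      ultimately have l: "p - \<delta> / 2 - \<delta> * l \<le> s" "s < q - \<delta> / 2 - \<delta> * l"
        using assms by (simp_all add: field_simps)
      have sh: "\<alpha> + \<delta> * (k - l) \<le> s" "s < \<beta> + \<delta> * (k - l)"
        using l by (simp_all add: \<alpha>_def \<beta>_def algebra_simps)
      consider "k = l" | "k - l \<ge> 1" | "k - l = -1" | "k - l \<le> -2" by linarith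
      then show ?thesis
      proof cases
        case 1
        with sh show ?thesis by simp
      next
        case 2
        then have "\<delta> * 1 \<le> \<delta> * real_of_int (k - l)"
          using assms by (intro mult_left_mono) auto
        then have "\<alpha> + \<delta> \<le> s" using sh by linarith
        with s \<alpha> show ?thesis by linarith
      next
        case 3
        with sh show ?thesis by (simp flip: of_int_diff)
      next
        case 4
        then have "\<delta> * real_of_int (k - l) \<le> \<delta> * (-2)"
          using assms by (intro mult_left_mono) (auto simp flip: of_int_diff)
        with sh s \<alpha> w False show ?thesis by simp
      qed
    qed
    show ?thesis
    \<comment> \<open>If \<beta> >= \<delta>, the interval wraps around and splits into two pieces
      of total length \<beta> - \<alpha>. Otherwise the translate by -\<delta> is negative and a
      degenerate second interval suffices.\<close>
    proof (cases "\<beta> \<ge> \<delta>")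
      case True
      have "{s. 0 \<le> s \<and> s < \<delta> \<and> rnd \<delta> (p - s) \<noteq> rnd \<delta> (q - s)} \<subseteq> {\<alpha>..\<delta>} \<union> {0..\<beta> - \<delta>}"
      proof
        fix s assume "s \<in> {s. 0 \<le> s \<and> s < \<delta> \<and> rnd \<delta> (p - s) \<noteq> rnd \<delta> (q - s)}"
        with cover[of s] show "s \<in> {\<alpha>..\<delta>} \<union> {0..\<beta> - \<delta>}" by auto
      qed
      moreover have "(\<delta> - \<alpha>) + (\<beta> - \<delta> - 0) \<le> \<bar>p - q\<bar>" "\<beta> - \<delta> \<le> \<delta>"
        using w le \<alpha> \<open>\<not> q - p \<ge> \<delta>\<close> by linarith+
      ultimately show ?thesis
        using True \<alpha> by (intro exI[of _ \<alpha>] exI[of _ \<delta>] exI[of _ 0] exI[of _ "\<beta> - \<delta>"] conjI; (assumption | linarith))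
    next
      case False
      have "{s. 0 \<le> s \<and> s < \<delta> \<and> rnd \<delta> (p - s) \<noteq> rnd \<delta> (q - s)} \<subseteq> {\<alpha>..\<beta>} \<union> {0..0}"
      proof
        fix s assume "s \<in> {s. 0 \<le> s \<and> s < \<delta> \<and> rnd \<delta> (p - s) \<noteq> rnd \<delta> (q - s)}"
        with cover[of s] False show "s \<in> {\<alpha>..\<beta>} \<union> {0..0}" by auto
      qed
      moreover have "(\<beta> - \<alpha>) + (0 - 0) \<le> \<bar>p - q\<bar>" "\<alpha> \<le> \<beta>"
        using w le by linarith+
      ultimately show ?thesis
        using False \<alpha> by (intro exI[of _ \<alpha>] exI[of _ \<beta>] exI[of _ 0] exI[of _ 0] conjI; (assumption | linarith))
    qed
  qed
qed

section \<open>Volumes and the separation probability of one coordinate\<close>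

lemma measure_lborel_slab:
  fixes i :: "'d::finite"
  assumes "a \<le> b" "\<delta> > 0"
  shows "measure lborel (cbox (\<chi> j. if j = i then a else 0) (\<chi> j. if j = i then b else \<delta>) :: (real ^ 'd) set)
    = (b - a) * \<delta> ^ (CARD('d) - 1)"
proof -
  have "cbox (\<chi> j. if j = i then a else 0) (\<chi> j. if j = i then b else \<delta>) \<noteq> ({} :: (real ^ 'd) set)"
    using assms by (auto simp: interval_ne_empty_cart)
  then have "measure lborel (cbox (\<chi> j. if j = i then a else 0) (\<chi> j. if j = i then b else \<delta>) :: (real ^ 'd) set)
      = (\<Prod>j\<in>UNIV. if j = i then b - a else \<delta>)"
    by (subst content_cbox_cart) (simp, intro prod.cong, simp_all)
  also have "\<dots> = (b - a) * (\<Prod>j\<in>UNIV - {i}. \<delta>)"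
    by (subst prod.remove[of _ i]) (auto intro!: prod.cong)
  finally show ?thesis by (simp add: card_Diff_singleton)
qed

lemma offsets_borel [measurable]: "(offsets \<delta> :: (real ^ 'd) set) \<in> sets borel"
  unfolding offsets_def by measurable

text \<open>The half-open cube lies between an open and a closed box of the same volume.\<close>

lemma measure_offsets:
  assumes "\<delta> > 0"
  shows "measure lborel (offsets \<delta> :: (real ^ 'd) set) = \<delta> ^ CARD('d)"
proof -
  let ?O = "offsets \<delta> :: (real ^ 'd) set"
  have sub: "box 0 (\<chi> i. \<delta>) \<subseteq> ?O" "?O \<subseteq> cbox 0 (\<chi> i. \<delta>)"
    by (force simp: offsets_def mem_box_cart less_imp_le)+
  have fm: "cbox 0 (\<chi> i. \<delta>) \<in> fmeasurable (lborel :: (real ^ 'd) measure)"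
    by (rule fmeasurable_cbox)
  have c: "measure lborel (cbox 0 (\<chi> i. \<delta>) :: (real ^ 'd) set) = \<delta> ^ CARD('d)"
    using assms by (subst content_cbox_cart) (auto simp: interval_ne_empty_cart)
  have "measure lborel ?O \<le> measure lborel (cbox 0 (\<chi> i. \<delta>) :: (real ^ 'd) set)"
    using sub(2) fm by (intro measure_mono_fmeasurable) auto
  moreover have "measure lborel (box 0 (\<chi> i. \<delta>) :: (real ^ 'd) set) \<le> measure lborel ?O"
    using sub fmeasurableI2[OF fm sub(2)] by (intro measure_mono_fmeasurable) auto
  ultimately show ?thesis using c by (simp add: measure_lborel_box_eq measure_lborel_cbox_eq)
qed

text \<open>Within the cube, the separating offsets lie in two slabs orthogonal to axis i with total
  thickness at most |p - q|. Dividing their volume by \<delta>^d leaves a single factor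
  1/\<delta>.\<close>

lemma prob_rnd_neq_le:
  fixes i :: "'d::finite"
  assumes "\<delta> > 0"
  shows "measure (random_offset \<delta>) {t :: real ^ 'd. rnd \<delta> (p - t $ i) \<noteq> rnd \<delta> (q - t $ i)} \<le> \<bar>p - q\<bar> / \<delta>"
proof -
  let ?O = "offsets \<delta> :: (real ^ 'd) set"
  let ?B = "{t :: real ^ 'd. rnd \<delta> (p - t $ i) \<noteq> rnd \<delta> (q - t $ i)}"
  let ?slab = "\<lambda>a b. cbox (\<chi> j. if j = i then a else 0) (\<chi> j. if j = i then b else \<delta>) :: (real ^ 'd) set"
  have meas: "?B \<in> sets borel" unfolding rnd_def by measurable
  obtain a b a' b' where ab: "a \<le> b" "a' \<le> b'" "(b - a) + (b' - a') \<le> \<bar>p - q\<bar>"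
    and cover: "{s. 0 \<le> s \<and> s < \<delta> \<and> rnd \<delta> (p - s) \<noteq> rnd \<delta> (q - s)} \<subseteq> {a..b} \<union> {a'..b'}"
    using rnd_neq_subset_intervals[OF assms, of p q] by blast
  have "?O \<inter> ?B \<subseteq> ?slab a b \<union> ?slab a' b'"
  proof
    fix t assume "t \<in> ?O \<inter> ?B"
    then have t: "\<And>j. 0 \<le> t $ j \<and> t $ j \<le> \<delta>" and "t $ i \<in> {a..b} \<union> {a'..b'}"
      using cover by (auto simp: offsets_def less_imp_le)
    then show "t \<in> ?slab a b \<union> ?slab a' b'" by (auto simp: mem_box_cart)
  qed
  then have "measure lborel (?O \<inter> ?B) \<le> measure lborel (?slab a b \<union> ?slab a' b')"
    using meas by (intro measure_mono_fmeasurable) (auto intro!: fmeasurable.Un)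
  also have "\<dots> \<le> measure lborel (?slab a b) + measure lborel (?slab a' b')"
    by (intro measure_Un_le) auto
  also have "\<dots> = ((b - a) + (b' - a')) * \<delta> ^ (CARD('d) - 1)"
    using ab assms by (simp add: measure_lborel_slab distrib_right)
  also have "\<dots> \<le> \<bar>p - q\<bar> * \<delta> ^ (CARD('d) - 1)"
    using ab assms by (intro mult_right_mono) auto
  finally have le: "measure lborel (?O \<inter> ?B) \<le> \<bar>p - q\<bar> * \<delta> ^ (CARD('d) - 1)" .
  \<comment> \<open>Both 0 and \<infinity> as \<open>emeasure\<close> would give the real
    \<open>measure\<close> 0, but the latter is \<delta>^d > 0.\<close>
  have "emeasure lborel ?O \<noteq> 0"
    using measure_offsets[OF assms, where 'd = 'd] assms by (auto simp: measure_def)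
  moreover have "emeasure lborel ?O \<noteq> \<infinity>"
    using measure_offsets[OF assms, where 'd = 'd] assms by (auto simp: measure_def)
  ultimately have "measure (random_offset \<delta>) ?B = measure lborel (?O \<inter> ?B) / \<delta> ^ CARD('d)"
    unfolding random_offset_def using meas
    by (simp add: measure_uniform_measure measure_offsets[OF assms])
  also have "\<dots> \<le> \<bar>p - q\<bar> * \<delta> ^ (CARD('d) - 1) / \<delta> ^ CARD('d)"
    using le assms by (intro divide_right_mono) auto
  also have "\<dots> = \<bar>p - q\<bar> / \<delta>"
    using assms by (simp add: power_eq_if[of \<delta> "CARD('d)"])
  finally show ?thesis .
qed

section \<open>Diameter of a rounding cell\<close>

text \<open>Numbers rounded to the same grid value lie in a common interval of length \<delta>, so p
  and q share a cube of side \<delta>.\<close>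

lemma norm_le_if_snap_eq:
  fixes p q t :: "real ^ 'd::{finite,linorder}"
  assumes "\<delta> > 0" "snap \<delta> t p = snap \<delta> t q"
  shows "norm (p - q) \<le> sqrt (real CARD('d)) * \<delta>"
proof -
  have "\<bar>p $ i - q $ i\<bar> \<le> \<delta>" for i
  proof -
    have eq: "rnd \<delta> (p $ i - t $ i) = rnd \<delta> (q $ i - t $ i)"
      using assms by (auto simp: snap_eq vec_eq_iff)
    have "\<bar>(p $ i - t $ i) / \<delta> - (q $ i - t $ i) / \<delta>\<bar> \<le> 1"
      using eq unfolding rnd_def by linarith
    then show ?thesis
      using assms(1) by (simp flip: diff_divide_distrib)
  qed
  then have "norm (p - q) \<le> L2_set (\<lambda>i. \<delta>) (UNIV :: 'd set)"
    unfolding norm_vec_def using assms(1) by (intro L2_set_mono) auto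
  also have "\<dots> = sqrt (real CARD('d)) * \<delta>"
    using assms(1) by (simp add: L2_set_def real_sqrt_mult)
  finally show ?thesis .
qed

section \<open>The locality-sensitive hashing guarantees\<close>

lemma dtw_le:
  assumes "traversal (length P) (length Q) T"
  shows "dtw P Q \<le> (\<Sum>(i, j)\<leftarrow>T. norm (P ! i - Q ! j))"
  unfolding dtw_def using assms finite_traversals
  by (intro Min_le) (auto simp: setcompr_eq_image)

lemma dtw_attained:
  "\<exists>T. traversal (length P) (length Q) T \<and> dtw P Q = (\<Sum>(i, j)\<leftarrow>T. norm (P ! i - Q ! j))"
proof -
  have "dtw P Q \<in> {(\<Sum>(i, j)\<leftarrow>T. norm (P ! i - Q ! j)) | T. traversal (length P) (length Q) T}"
    unfolding dtw_def using finite_traversals traversal_exists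
    by (intro Min_in) (auto simp: setcompr_eq_image)
  then show ?thesis by blast
qed

text \<open>The traversal along which the snapped vertices match may fail to be optimal for P and Q,
  but its cost still bounds the minimum from above.\<close>

lemma dtw_le_if_hash_eq:
  fixes P Q :: "(real ^ 'd::{finite,linorder}) list"
  assumes "\<delta> > 0" "P \<noteq> []" "Q \<noteq> []" "hash \<delta> t P = hash \<delta> t Q"
  shows "dtw P Q \<le> real (length P + length Q - 1) * (sqrt (real CARD('d)) * \<delta>)"
proof -
  obtain T where T: "traversal (length P) (length Q) T"
    and eq: "\<And>i j. (i, j) \<in> set T \<Longrightarrow> map (snap \<delta> t) P ! i = map (snap \<delta> t) Q ! j"
    using traversal_if_remdups_adj_eq[of "map (snap \<delta> t) P" "map (snap \<delta> t) Q"] assms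
    by (auto simp: hash_def)
  have ij: "i < length P" "j < length Q" if mem: "(i, j) \<in> set T" for i j
    using traversal_less[OF T _ _ mem] assms(2,3) by auto
  have "dtw P Q \<le> (\<Sum>(i, j)\<leftarrow>T. norm (P ! i - Q ! j))"
    by (rule dtw_le[OF T])
  also have "\<dots> \<le> (\<Sum>_\<leftarrow>T. sqrt (real CARD('d)) * \<delta>)"
    using eq ij by (intro sum_list_mono) (auto intro!: norm_le_if_snap_eq[OF assms(1), of t])
  also have "\<dots> = real (length T) * (sqrt (real CARD('d)) * \<delta>)"
    by (simp add: sum_list_triv)
  also have "\<dots> \<le> real (length P + length Q - 1) * (sqrt (real CARD('d)) * \<delta>)"
    using length_traversal_le[OF T] assms by (intro mult_right_mono) auto
  finally show ?thesis .
qed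

lemma prob_hash_neq_le:
  fixes P Q :: "(real ^ 'd::{finite,linorder}) list"
  assumes "\<delta> > 0" "P \<noteq> []" "Q \<noteq> []"
  shows "measure (random_offset \<delta>) {t. hash \<delta> t P \<noteq> hash \<delta> t Q} \<le> real CARD('d) * dtw P Q / \<delta>"
proof -
  interpret prob_space "random_offset \<delta> :: (real ^ 'd::{finite,linorder}) measure"
    by (rule prob_space_random_offset[OF assms(1)])
  obtain T where T: "traversal (length P) (length Q) T"
    and dtw: "dtw P Q = (\<Sum>(i, j)\<leftarrow>T. norm (P ! i - Q ! j))"
    using dtw_attained by blast
  \<comment> \<open>Events are indexed by positions in \<open>T\<close>, so the union bound sums
    over exactly the terms of the list sum that equals \<open>dtw P Q\<close>.\<close>
  define p where "p k = P ! fst (T ! k)" for k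
  define q where "q k = Q ! snd (T ! k)" for k
  define B where "B = (\<lambda>(k, i). {t :: real ^ 'd::{finite,linorder}. rnd \<delta> (p k $ i - t $ i) \<noteq> rnd \<delta> (q k $ i - t $ i)})"
  let ?I = "{..<length T} \<times> (UNIV :: 'd set)"
  have meas: "B ki \<in> events" for ki
    unfolding B_def rnd_def case_prod_beta sets_random_offset by measurable
  have sub: "{t. hash \<delta> t P \<noteq> hash \<delta> t Q} \<subseteq> (\<Union>ki\<in>?I. B ki)"
  proof (rule ccontr)
    assume "\<not> ?thesis"
    then obtain t where neq: "hash \<delta> t P \<noteq> hash \<delta> t Q" and t: "\<And>ki. ki \<in> ?I \<Longrightarrow> t \<notin> B ki"
      by blast
    have ij: "map (snap \<delta> t) P ! i = map (snap \<delta> t) Q ! j" if mem: "(i, j) \<in> set T" for i j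
    proof -
      obtain k where k: "k < length T" "T ! k = (i, j)"
        using mem unfolding in_set_conv_nth by blast
      have "i < length P" "j < length Q"
        using traversal_less[OF T _ _ mem] assms(2,3) by auto
      moreover have "snap \<delta> t (P ! i) = snap \<delta> t (Q ! j)"
        using t[of "(k, _)"] k by (auto simp: snap_eq[OF assms(1)] vec_eq_iff B_def p_def q_def)
      ultimately show ?thesis by simp
    qed
    have "hash \<delta> t P = hash \<delta> t Q"
      unfolding hash_def using T assms ij by (intro remdups_adj_eq_if_traversal[of _ _ T]) auto
    with neq show False ..
  qed
  have "prob {t. hash \<delta> t P \<noteq> hash \<delta> t Q} \<le> prob (\<Union>ki\<in>?I. B ki)"
    using sub meas by (intro finite_measure_mono) auto
  also have "\<dots> \<le> (\<Sum>ki\<in>?I. prob (B ki))"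
    using meas by (intro finite_measure_subadditive_finite) auto
  also have "\<dots> \<le> (\<Sum>(k, i)\<in>?I. norm (p k - q k) / \<delta>)"
  proof (rule sum_mono, clarify)
    fix k i
    have "prob (B (k, i)) \<le> \<bar>p k $ i - q k $ i\<bar> / \<delta>"
      unfolding B_def using prob_rnd_neq_le[OF assms(1)] by simp
    \<comment> \<open>Bounding each coordinate difference by the full norm produces the factor d
      after summation over the coordinates.\<close>
    also have "\<dots> \<le> norm (p k - q k) / \<delta>"
      using component_le_norm_cart[of "p k - q k" i] assms(1) by (simp add: divide_right_mono)
    finally show "prob (B (k, i)) \<le> norm (p k - q k) / \<delta>" .
  qed
  also have "\<dots> = real CARD('d) * dtw P Q / \<delta>"
    by (simp add: dtw sum_list_sum_nth sum.cartesian_product' case_prod_beta p_def q_def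
        atLeast0LessThan sum_divide_distrib sum_distrib_left)
  finally show ?thesis .
qed

theorem theorem20:
  fixes P Q :: "(real ^ 'd::{finite,linorder}) list"
    and m\<^sub>1 m\<^sub>2 M :: nat
    and r \<delta> c :: real
  assumes "P \<noteq> []" and "Q \<noteq> []"
    and "m\<^sub>1 = length P" and "m\<^sub>2 = length Q"
    and "M = max m\<^sub>1 m\<^sub>2"
    and "r > 0"
    and "\<delta> = 2 * real CARD('d) * r"
    and "c = 4 * real CARD('d) powr (3 / 2) * real M"
  shows "(dtw P Q < r \<longrightarrow> \<P>(t in random_offset \<delta>. hash \<delta> t P = hash \<delta> t Q) > 1 / 2) \<and>
         (dtw P Q > c * r \<longrightarrow> \<P>(t in random_offset \<delta>. hash \<delta> t P = hash \<delta> t Q) = 0)"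
proof (intro conjI impI)
  let ?d = "real CARD('d)"
  have \<delta>: "\<delta> > 0" using assms by simp
  interpret prob_space "random_offset \<delta> :: (real ^ 'd::{finite,linorder}) measure"
    by (rule prob_space_random_offset[OF \<delta>])
  {
    assume "dtw P Q < r"
    have "prob {t. hash \<delta> t P \<noteq> hash \<delta> t Q} \<le> ?d * dtw P Q / \<delta>"
      by (rule prob_hash_neq_le[OF \<delta> assms(1,2)])
    also have "\<dots> < ?d * r / \<delta>"
      using \<open>dtw P Q < r\<close> \<delta> by (simp add: divide_strict_right_mono)
    also have "\<dots> = 1 / 2" using assms by simp
    \<comment> \<open>Equality of the hashes is measurable, so its probability is one minus that of
      the complement, which is below 1/2.\<close>
    finally show "\<P>(t in random_offset \<delta>. hash \<delta> t P = hash \<delta> t Q) > 1 / 2"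
      using prob_neg[OF hash_eq_event[OF \<delta>, of P Q]] by simp
  next
    assume large: "dtw P Q > c * r"
    \<comment> \<open>No offset at all gives a collision, so the event is empty.\<close>
    have "hash \<delta> t P \<noteq> hash \<delta> t Q" for t
    proof
      assume "hash \<delta> t P = hash \<delta> t Q"
      then have "dtw P Q \<le> real (length P + length Q - 1) * (sqrt ?d * \<delta>)"
        by (rule dtw_le_if_hash_eq[OF \<delta> assms(1,2)])
      \<comment> \<open>The length bound m1 + m2 - 1 is relaxed to 2M; with \<delta> = 2dr this
        makes the product exactly 4 d^(3/2) M r.\<close>
      also have "\<dots> \<le> real (2 * M) * (sqrt ?d * \<delta>)"
        using assms(3-5) \<delta> by (intro mult_right_mono) auto
      also have "\<dots> = c * r"
      proof -
        have "?d powr (3 / 2) = ?d powr (1 + 1 / 2)" by simp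
        also have "\<dots> = ?d * sqrt ?d" by (simp only: powr_add powr_half_sqrt) simp
        finally show ?thesis using assms(7,8) by simp
      qed
      finally show False using large by simp
    qed
    then show "\<P>(t in random_offset \<delta>. hash \<delta> t P = hash \<delta> t Q) = 0" by simp
  }
qed

end
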